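(* Let $(\mathcal T_\kappa)_{\kappa\in I}$ be a derivation of the procedure STAB. (1) If there exists $\iota\in I$ such that $\mathcal T_\iota$ contains an irreducible, not closed leaf, then $\mathcal T_0$ is satisfiable. (2) If the derivation is fair and if $\mathcal T_0$ is satisfiable, then there exist $\iota\in I$ and a leaf in $\mathcal T_\iota$ that is irreducible and neither closed nor blocked.
   Context: Schemata. Fix a countably infinite set of arithmetic variables and a countably infinite set $\mathcal P$ of propositional symbols. Linear arithmetic expressions are built from arithmetic variables and $0,s,+,-$, modulo the usual arithmetic laws. An indexed proposition is $p_a$ with $p\in\mathcal P$ and $a$ a linear arithmetic expression; if $a\in\mathbb Z$ it is called a propositional variable. Schemata form the smallest set such that: $\top,\bot$, $a<b$ ($a,b$ linear arithmetic expressions) and indexed propositions are schemata; schemata are closed under $\vee,\wedge,\neg$; if $\phi$ is a schema not containing $<$, $i$ is an arithmetic variable and $a,b$ are linear arithmetic expressions, then $\bigwedge_{i=a}^b\phi$ and $\bigvee_{i=a}^b\phi$ are schemata (iterations). A variable is bound in $\phi$ if $\phi$ contains an iteration over it, and free (a parameter) if it occurs outside the scope of every iteration over it; no variable is both free and bound, and distinct iterations use distinct variables. $a\le b$, $a=b$, $a\neq b$ are the usual abbreviations. An arithmetic formula is a schema without iterations all of whose atoms are $\top$, $\bot$ or of the form $a<b$; arithmetic formulae are taken up to arithmetic equivalence. Schemata are assumed to be in negation normal form. Semantics. An interpretation $\mathcal I$ maps every arithmetic variable to a natural number (standing assumption) and every propositional variable $p_\alpha$ ($\alpha\in\mathbb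 Z$) to a truth value; $[\![a]\!]_{\mathcal I}$ is the integer value of $a$. $a<b$ is true iff $[\![a]\!]_{\mathcal I}<[\![b]\!]_{\mathcal I}$; $p_a$ has the value $\mathcal I(p_{[\![a]\!]_{\mathcal I}})$; connectives are as usual; $\bigvee_{i=a}^b\phi$ (resp. $\bigwedge_{i=a}^b\phi$) is true in $\mathcal I$ iff $\phi$ is true when $i$ is given the value $\alpha$, for some (resp. every) integer $\alpha$ with $[\![a]\!]_{\mathcal I}\le\alpha\le[\![b]\!]_{\mathcal I}$. $\mathcal I\models\phi$ means $\phi$ is true in $\mathcal I$; a set of schemata is read as the conjunction of its elements. Tableaux. A tableau $\mathcal T$ is a tree whose nodes $N$ are labeled by sets of schemata $\Phi_{\mathcal T}(N)$. $\mathcal T$ is satisfied in $\mathcal I$ iff $\mathcal I\models\Phi_{\mathcal T}(N)$ for some leaf $N$; it is satisfiable iff it is satisfied in some $\mathcal I$. Applying an extension rule with premises $P$ and conclusions $C_1|\dots|C_k$ to a leaf $N$ whose label contains $P$ adds $k$ children to $N$, labeled $C_\iota\cup(\Phi_{\mathcal T}(N)\setminus P)$. The extension rules are: ($\wedge$) from $\phi\wedge\psi$: the single conclusion $\{\phi,\psi\}$; ($\vee$) from $\phi\vee\psi$: conclusions $\{\phi\}\mid\{\psi\}$; (Iterated $\wedge$) from $\bigwedge_{i=a}^b\phi$: conclusions $\{\bigwedge_{i=a}^{b-1}\phi\wedge\phi[b/i],\ b\ge a\}\mid\{b<a\}$; (Iterated $\vee$) from $\bigvee_{i=a}^b\phi$: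 the single conclusion $\{\bigvee_{i=a}^{b-1}\phi\vee\phi[b/i],\ b\ge a\}$; (Closure) from $p_a,\neg p_b$: the single conclusion $\{p_a,\neg p_b,a\neq b\}$, applied only if $a\neq b$ does not already occur in the branch. A leaf is closed if the set of arithmetic formulae in its label is unsatisfiable, or if it is blocked. Blocking: a shift is a substitution $\sigma$ mapping every arithmetic variable $n$ to an expression $n-\iota_n$ with $\iota_n\in\mathbb N$, where $\iota_n>0$ for at least one $n$. $\mathcal I\sigma$ denotes the interpretation that agrees with $\mathcal I$ on propositional variables and maps each $n$ to $[\![n\sigma]\!]_{\mathcal I}$. Write $\mathcal J<\mathcal I$ iff $\mathcal J=\mathcal I\sigma$ for some shift $\sigma$. Write $\Phi\models_s\Psi$ iff for every model $\mathcal I$ of $\Phi$ there is $\mathcal J<\mathcal I$ with $\mathcal J\models\Psi$. A node $N'$ loops on a node $N$ of $\mathcal T$ (possibly on a different branch) iff $\Phi_{\mathcal T}(N')\models_s\Phi_{\mathcal T}(N)$; a leaf that loops on a node is called blocked. A leaf is irreducible if no extension rule applies to it. A derivation is a finite or infinite sequence of tableaux $(\mathcal T_\iota)_{\iota\in I}$, with $I=[0,\kappa]$ for some $\kappa\ge0$ or $I=\mathbb N$, where $\mathcal T_0$ consists of a single node and each $\mathcal T_\iota$, $\iota>0$, is obtained from $\mathcal T_{\iota-1}$ by applying an extension rule. A derivation is fair if either some $\mathcal T_\iota$ contains an irreducible, not closed leaf, or for all $\iota\in I$ and every leaf $N$ of $\mathcal T_\iota$ that is neither closed nor blocked there is $\lambda\ge\iota$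 such that a rule is applied on $N$ in $\mathcal T_\lambda$.
   Formalization: Part (2) additionally assumes that the root of T_0 is labeled by a finite set of schemata; for infinite labels it fails, e.g. for the root {p_k ∧ p_k : k in N}, whose fair derivation never reaches an irreducible leaf. *)

theory Defs
  imports Main "HOL-Library.Sublist"
begin

section \<open>Linear arithmetic expressions\<close>

type_synonym avar = nat
type_synonym psym = nat

datatype aterm = TVar avar | TZero | TSuc aterm | TPlus aterm aterm | TMinus aterm aterm

primrec tval :: "(avar \<Rightarrow> int) \<Rightarrow> aterm \<Rightarrow> int" where
  "tval \<nu> (TVar n) = \<nu> n"
| "tval \<nu> TZero = 0"
| "tval \<nu> (TSuc t) = tval \<nu> t + 1"
| "tval \<nu> (TPlus s t) = tval \<nu> s + tval \<nu> t"
| "tval \<nu> (TMinus s t) = tval \<nu> s - tval \<nu> t"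

primrec tsubst :: "avar \<Rightarrow> aterm \<Rightarrow> aterm \<Rightarrow> aterm" where
  "tsubst i u (TVar n) = (if n = i then u else TVar n)"
| "tsubst i u TZero = TZero"
| "tsubst i u (TSuc t) = TSuc (tsubst i u t)"
| "tsubst i u (TPlus s t) = TPlus (tsubst i u s) (tsubst i u t)"
| "tsubst i u (TMinus s t) = TMinus (tsubst i u s) (tsubst i u t)"

lemma tval_tsubst: "tval \<nu> (tsubst i u t) = tval (\<nu>(i := tval \<nu> u)) t"
  by (induction t) auto

text \<open>Two terms are equal modulo the arithmetic laws iff they denote the same affine function
  over the integers.\<close>

quotient_type lexp = aterm / "\<lambda>s t. \<forall>\<nu>. tval \<nu> s = tval \<nu> t"
  by (auto intro!: equivpI reflpI sympI transpI)

lift_definition leval :: "(avar \<Rightarrow> int) \<Rightarrow> lexp \<Rightarrow> int" is tval by simp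

lift_definition LVar :: "avar \<Rightarrow> lexp" is TVar .

lift_definition LSuc :: "lexp \<Rightarrow> lexp" is TSuc by simp

lift_definition lsubst :: "avar \<Rightarrow> lexp \<Rightarrow> lexp \<Rightarrow> lexp" is tsubst
  by (simp add: tval_tsubst)

instantiation lexp :: "{zero, plus, minus}"
begin
lift_definition zero_lexp :: lexp is TZero .
lift_definition plus_lexp :: "lexp \<Rightarrow> lexp \<Rightarrow> lexp" is TPlus by simp
lift_definition minus_lexp :: "lexp \<Rightarrow> lexp \<Rightarrow> lexp" is TMinus by simp
instance ..
end

definition lnum :: "nat \<Rightarrow> lexp" where
  "lnum k = (LSuc ^^ k) 0"

text \<open>A variable occurs in a class of terms iff it cannot be cancelled, i.e. iff its coefficient
  in the affine normal form is nonzero; equivalently, the value depends on it.\<close>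

definition lvars :: "lexp \<Rightarrow> avar set" where
  "lvars a = {n. \<exists>\<nu> k. leval (\<nu>(n := k)) a \<noteq> leval \<nu> a}"


section \<open>Schemata\<close>

datatype schema =
    Top
  | Bot
  | Less lexp lexp
  | IProp psym lexp
  | Neg schema
  | Conj schema schema
  | Disj schema schema
  | BigConj avar lexp lexp schema
  | BigDisj avar lexp lexp schema

definition Geq :: "lexp \<Rightarrow> lexp \<Rightarrow> schema" where
  "Geq b a = Neg (Less b a)"

text \<open>The negation normal form of the negation of equality.\<close>

definition Neq :: "lexp \<Rightarrow> lexp \<Rightarrow> schema" where
  "Neq a b = Disj (Less a b) (Less b a)"

primrec less_free :: "schema \<Rightarrow> bool" where
  "less_free Top = True"
| "less_free Bot = True"
| "less_free (Less a b) = False"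
| "less_free (IProp p a) = True"
| "less_free (Neg \<phi>) = less_free \<phi>"
| "less_free (Conj \<phi> \<psi>) = (less_free \<phi> \<and> less_free \<psi>)"
| "less_free (Disj \<phi> \<psi>) = (less_free \<phi> \<and> less_free \<psi>)"
| "less_free (BigConj i a b \<phi>) = less_free \<phi>"
| "less_free (BigDisj i a b \<phi>) = less_free \<phi>"

primrec iter_bodies_ok :: "schema \<Rightarrow> bool" where
  "iter_bodies_ok Top = True"
| "iter_bodies_ok Bot = True"
| "iter_bodies_ok (Less a b) = True"
| "iter_bodies_ok (IProp p a) = True"
| "iter_bodies_ok (Neg \<phi>) = iter_bodies_ok \<phi>"
| "iter_bodies_ok (Conj \<phi> \<psi>) = (iter_bodies_ok \<phi> \<and> iter_bodies_ok \<psi>)"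
| "iter_bodies_ok (Disj \<phi> \<psi>) = (iter_bodies_ok \<phi> \<and> iter_bodies_ok \<psi>)"
| "iter_bodies_ok (BigConj i a b \<phi>) = (less_free \<phi> \<and> iter_bodies_ok \<phi>)"
| "iter_bodies_ok (BigDisj i a b \<phi>) = (less_free \<phi> \<and> iter_bodies_ok \<phi>)"

primrec free_vars :: "schema \<Rightarrow> avar set" where
  "free_vars Top = {}"
| "free_vars Bot = {}"
| "free_vars (Less a b) = lvars a \<union> lvars b"
| "free_vars (IProp p a) = lvars a"
| "free_vars (Neg \<phi>) = free_vars \<phi>"
| "free_vars (Conj \<phi> \<psi>) = free_vars \<phi> \<union> free_vars \<psi>"
| "free_vars (Disj \<phi> \<psi>) = free_vars \<phi> \<union> free_vars \<psi>"
| "free_vars (BigConj i a b \<phi>) = lvars a \<union> lvars b \<union> (free_vars \<phi> - {i})"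
| "free_vars (BigDisj i a b \<phi>) = lvars a \<union> lvars b \<union> (free_vars \<phi> - {i})"

text \<open>The list of iteration variables, with one entry per iteration.\<close>

primrec bound_vars :: "schema \<Rightarrow> avar list" where
  "bound_vars Top = []"
| "bound_vars Bot = []"
| "bound_vars (Less a b) = []"
| "bound_vars (IProp p a) = []"
| "bound_vars (Neg \<phi>) = bound_vars \<phi>"
| "bound_vars (Conj \<phi> \<psi>) = bound_vars \<phi> @ bound_vars \<psi>"
| "bound_vars (Disj \<phi> \<psi>) = bound_vars \<phi> @ bound_vars \<psi>"
| "bound_vars (BigConj i a b \<phi>) = i # bound_vars \<phi>"
| "bound_vars (BigDisj i a b \<phi>) = i # bound_vars \<phi>"

primrec is_atom :: "schema \<Rightarrow> bool" where
  "is_atom Top = True"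
| "is_atom Bot = True"
| "is_atom (Less a b) = True"
| "is_atom (IProp p a) = True"
| "is_atom (Neg \<phi>) = False"
| "is_atom (Conj \<phi> \<psi>) = False"
| "is_atom (Disj \<phi> \<psi>) = False"
| "is_atom (BigConj i a b \<phi>) = False"
| "is_atom (BigDisj i a b \<phi>) = False"

primrec nnf :: "schema \<Rightarrow> bool" where
  "nnf Top = True"
| "nnf Bot = True"
| "nnf (Less a b) = True"
| "nnf (IProp p a) = True"
| "nnf (Neg \<phi>) = is_atom \<phi>"
| "nnf (Conj \<phi> \<psi>) = (nnf \<phi> \<and> nnf \<psi>)"
| "nnf (Disj \<phi> \<psi>) = (nnf \<phi> \<and> nnf \<psi>)"
| "nnf (BigConj i a b \<phi>) = nnf \<phi>"
| "nnf (BigDisj i a b \<phi>) = nnf \<phi>"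

definition wf_schema :: "schema \<Rightarrow> bool" where
  "wf_schema \<phi> \<longleftrightarrow>
     iter_bodies_ok \<phi> \<and> nnf \<phi> \<and>
     free_vars \<phi> \<inter> set (bound_vars \<phi>) = {} \<and> distinct (bound_vars \<phi>)"

primrec is_arith :: "schema \<Rightarrow> bool" where
  "is_arith Top = True"
| "is_arith Bot = True"
| "is_arith (Less a b) = True"
| "is_arith (IProp p a) = False"
| "is_arith (Neg \<phi>) = is_arith \<phi>"
| "is_arith (Conj \<phi> \<psi>) = (is_arith \<phi> \<and> is_arith \<psi>)"
| "is_arith (Disj \<phi> \<psi>) = (is_arith \<phi> \<and> is_arith \<psi>)"
| "is_arith (BigConj i a b \<phi>) = False"
| "is_arith (BigDisj i a b \<phi>) = False"

text \<open>Substitution of an expression for the free occurrences of a variable. It does not rename.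
  The iteration rules use it only as \<open>ssubst i b \<phi>\<close> for the body \<open>\<phi>\<close> of an iteration over \<open>i\<close> with
  upper bound \<open>b\<close>; starting from schemata satisfying \<open>wf_schema\<close>, the variables of \<open>b\<close> are then
  never bound in \<open>\<phi>\<close>, so that no capture occurs.\<close>

primrec ssubst :: "avar \<Rightarrow> lexp \<Rightarrow> schema \<Rightarrow> schema" where
  "ssubst i e Top = Top"
| "ssubst i e Bot = Bot"
| "ssubst i e (Less a b) = Less (lsubst i e a) (lsubst i e b)"
| "ssubst i e (IProp p a) = IProp p (lsubst i e a)"
| "ssubst i e (Neg \<phi>) = Neg (ssubst i e \<phi>)"
| "ssubst i e (Conj \<phi> \<psi>) = Conj (ssubst i e \<phi>) (ssubst i e \<psi>)"
| "ssubst i e (Disj \<phi> \<psi>) = Disj (ssubst i e \<phi>) (ssubst i e \<psi>)"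
| "ssubst i e (BigConj j a b \<phi>) =
     BigConj j (lsubst i e a) (lsubst i e b) (if j = i then \<phi> else ssubst i e \<phi>)"
| "ssubst i e (BigDisj j a b \<phi>) =
     BigDisj j (lsubst i e a) (lsubst i e b) (if j = i then \<phi> else ssubst i e \<phi>)"


section \<open>Semantics\<close>

text \<open>Parameters take natural values, but an iteration variable ranges over an integer interval
  that may contain negative numbers. Truth is therefore defined for integer assignments.\<close>

datatype interp = Interp (aint: "avar \<Rightarrow> nat") (pint: "psym \<Rightarrow> int \<Rightarrow> bool")

primrec holds :: "(psym \<Rightarrow> int \<Rightarrow> bool) \<Rightarrow> (avar \<Rightarrow> int) \<Rightarrow> schema \<Rightarrow> bool" where
  "holds P \<nu> Top = True"
| "holds P \<nu> Bot = False"
| "holds P \<nu> (Less a b) = (leval \<nu> a < leval \<nu> b)"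
| "holds P \<nu> (IProp p a) = P p (leval \<nu> a)"
| "holds P \<nu> (Neg \<phi>) = (\<not> holds P \<nu> \<phi>)"
| "holds P \<nu> (Conj \<phi> \<psi>) = (holds P \<nu> \<phi> \<and> holds P \<nu> \<psi>)"
| "holds P \<nu> (Disj \<phi> \<psi>) = (holds P \<nu> \<phi> \<or> holds P \<nu> \<psi>)"
| "holds P \<nu> (BigConj i a b \<phi>) =
     (\<forall>\<alpha>. leval \<nu> a \<le> \<alpha> \<and> \<alpha> \<le> leval \<nu> b \<longrightarrow> holds P (\<nu>(i := \<alpha>)) \<phi>)"
| "holds P \<nu> (BigDisj i a b \<phi>) =
     (\<exists>\<alpha>. leval \<nu> a \<le> \<alpha> \<and> \<alpha> \<le> leval \<nu> b \<and> holds P (\<nu>(i := \<alpha>)) \<phi>)"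

definition ieval :: "interp \<Rightarrow> lexp \<Rightarrow> int" where
  "ieval I a = leval (\<lambda>n. int (aint I n)) a"

definition models :: "interp \<Rightarrow> schema \<Rightarrow> bool" where
  "models I \<phi> \<longleftrightarrow> holds (pint I) (\<lambda>n. int (aint I n)) \<phi>"

definition models_set :: "interp \<Rightarrow> schema set \<Rightarrow> bool" where
  "models_set I \<Phi> \<longleftrightarrow> (\<forall>\<phi>\<in>\<Phi>. models I \<phi>)"

definition sem_equiv :: "schema \<Rightarrow> schema \<Rightarrow> bool" where
  "sem_equiv \<phi> \<psi> \<longleftrightarrow> (\<forall>I. models I \<phi> \<longleftrightarrow> models I \<psi>)"

definition is_shift :: "(avar \<Rightarrow> lexp) \<Rightarrow> bool" where
  "is_shift \<sigma> \<longleftrightarrow> (\<exists>\<iota>. (\<forall>n. \<sigma> n = LVar n - lnum (\<iota> n)) \<and> (\<exists>n. \<iota> n > 0))"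

text \<open>\<open>is_subst_interp I \<sigma> J\<close> reads J = I\<open>\<sigma>\<close>. It is a relation because I\<open>\<sigma>\<close> is an interpretation
  only if every \<open>\<sigma> n\<close> has a nonnegative value in I.\<close>

definition is_subst_interp :: "interp \<Rightarrow> (avar \<Rightarrow> lexp) \<Rightarrow> interp \<Rightarrow> bool" where
  "is_subst_interp I \<sigma> J \<longleftrightarrow> pint J = pint I \<and> (\<forall>n. int (aint J n) = ieval I (\<sigma> n))"

definition interp_less :: "interp \<Rightarrow> interp \<Rightarrow> bool" where
  "interp_less J I \<longleftrightarrow> (\<exists>\<sigma>. is_shift \<sigma> \<and> is_subst_interp I \<sigma> J)"

definition shift_entails :: "schema set \<Rightarrow> schema set \<Rightarrow> bool" where
  "shift_entails \<Phi> \<Psi> \<longleftrightarrow>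
     (\<forall>I. models_set I \<Phi> \<longrightarrow> (\<exists>J. interp_less J I \<and> models_set J \<Psi>))"


section \<open>Tableaux\<close>

text \<open>Nodes are addressed by their path from the root: the children of \<open>N\<close> are \<open>N @ [0]\<close>,
  \<open>N @ [1]\<close>, and so on. A tableau maps the addresses of its nodes to their labels. Node addresses
  are stable along a derivation.\<close>

type_synonym node = "nat list"
type_synonym tableau = "node \<Rightarrow> schema set option"

definition nodes :: "tableau \<Rightarrow> node set" where
  "nodes T = dom T"

definition label :: "tableau \<Rightarrow> node \<Rightarrow> schema set" where
  "label T N = the (T N)"

definition leaves :: "tableau \<Rightarrow> node set" where
  "leaves T = {N \<in> nodes T. \<forall>k. N @ [k] \<notin> nodes T}"

definition satisfied_in :: "tableau \<Rightarrow> interp \<Rightarrow> bool" where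
  "satisfied_in T I \<longleftrightarrow> (\<exists>N\<in>leaves T. models_set I (label T N))"

definition satisfiable :: "tableau \<Rightarrow> bool" where
  "satisfiable T \<longleftrightarrow> (\<exists>I. satisfied_in T I)"

definition branch_schemata :: "tableau \<Rightarrow> node \<Rightarrow> schema set" where
  "branch_schemata T N = (\<Union>M\<in>{M \<in> nodes T. prefix M N}. label T M)"

text \<open>Since arithmetic formulae are identified up to equivalence, so is the occurrence of the
  disequation tested by the closure rule.\<close>

definition occurs_upto :: "schema set \<Rightarrow> schema \<Rightarrow> bool" where
  "occurs_upto B \<phi> \<longleftrightarrow> (\<exists>\<chi>\<in>B. is_arith \<chi> \<and> sem_equiv \<chi> \<phi>)"

text \<open>\<open>ext_rule B P Cs\<close>: an instance with premises \<open>P\<close> and conclusions \<open>Cs\<close>, admissible on a branch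
  whose schemata are \<open>B\<close>. Conjunctions and disjunctions are decomposed syntactically, also when they
  are arithmetic: up to equivalence every arithmetic formula is a conjunction, and a leaf
  containing one would never be irreducible.\<close>

inductive ext_rule :: "schema set \<Rightarrow> schema set \<Rightarrow> schema set list \<Rightarrow> bool" for B where
  and_rule: "ext_rule B {Conj \<phi> \<psi>} [{\<phi>, \<psi>}]"
| or_rule: "ext_rule B {Disj \<phi> \<psi>} [{\<phi>}, {\<psi>}]"
| iterated_and: "ext_rule B {BigConj i a b \<phi>}
    [{Conj (BigConj i a (b - lnum 1) \<phi>) (ssubst i b \<phi>), Geq b a}, {Less b a}]"
| iterated_or: "ext_rule B {BigDisj i a b \<phi>}
    [{Disj (BigDisj i a (b - lnum 1) \<phi>) (ssubst i b \<phi>), Geq b a}]"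
| closure: "\<not> occurs_upto B (Neq a b) \<Longrightarrow>
    ext_rule B {IProp p a, Neg (IProp p b)} [{IProp p a, Neg (IProp p b), Neq a b}]"

definition extend :: "tableau \<Rightarrow> node \<Rightarrow> schema set \<Rightarrow> schema set list \<Rightarrow> tableau" where
  "extend T N P Cs = (\<lambda>M. if \<exists>k<length Cs. M = N @ [k]
     then Some (Cs ! last M \<union> (label T N - P)) else T M)"

definition rule_applied :: "tableau \<Rightarrow> node \<Rightarrow> tableau \<Rightarrow> bool" where
  "rule_applied T N T' \<longleftrightarrow> N \<in> leaves T \<and>
     (\<exists>P Cs. ext_rule (branch_schemata T N) P Cs \<and> P \<subseteq> label T N \<and> T' = extend T N P Cs)"

definition irreducible_leaf :: "tableau \<Rightarrow> node \<Rightarrow> bool" where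
  "irreducible_leaf T N \<longleftrightarrow> N \<in> leaves T \<and> (\<nexists>T'. rule_applied T N T')"

definition loops_on :: "tableau \<Rightarrow> node \<Rightarrow> node \<Rightarrow> bool" where
  "loops_on T N' N \<longleftrightarrow> shift_entails (label T N') (label T N)"

definition blocked :: "tableau \<Rightarrow> node \<Rightarrow> bool" where
  "blocked T N' \<longleftrightarrow> N' \<in> leaves T \<and> (\<exists>N\<in>nodes T. loops_on T N' N)"

definition closed_leaf :: "tableau \<Rightarrow> node \<Rightarrow> bool" where
  "closed_leaf T N \<longleftrightarrow> N \<in> leaves T \<and>
     ((\<nexists>I. models_set I {\<phi> \<in> label T N. is_arith \<phi>}) \<or> blocked T N)"


section \<open>Derivations\<close>

text \<open>Well-formedness is imposed on the root only: the iteration rules duplicate the body of an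
  iteration, so that later labels need not have distinct bound variables without renaming.\<close>

definition derivation :: "nat set \<Rightarrow> (nat \<Rightarrow> tableau) \<Rightarrow> bool" where
  "derivation I T \<longleftrightarrow>
     ((\<exists>\<kappa>. I = {0..\<kappa>}) \<or> I = UNIV) \<and>
     (\<exists>\<Phi>. (\<forall>\<phi>\<in>\<Phi>. wf_schema \<phi>) \<and> T 0 = [[] \<mapsto> \<Phi>]) \<and>
     (\<forall>\<iota>\<in>I. \<iota> > 0 \<longrightarrow> (\<exists>N. rule_applied (T (\<iota> - 1)) N (T \<iota>)))"

definition fair :: "nat set \<Rightarrow> (nat \<Rightarrow> tableau) \<Rightarrow> bool" where
  "fair I T \<longleftrightarrow>
     (\<exists>\<iota>\<in>I. \<exists>N\<in>leaves (T \<iota>). irreducible_leaf (T \<iota>) N \<and> \<not> closed_leaf (T \<iota>) N) \<or>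
     (\<forall>\<iota>\<in>I. \<forall>N\<in>leaves (T \<iota>). \<not> closed_leaf (T \<iota>) N \<and> \<not> blocked (T \<iota>) N \<longrightarrow>
        (\<exists>\<mu>\<ge>\<iota>. Suc \<mu> \<in> I \<and> rule_applied (T \<mu>) N (T (Suc \<mu>))))"

end

theory Submission
  imports Defs
begin

text \<open>(1) The arithmetic formulae of an open irreducible leaf have a model, which extends to the
  propositional literals because the closure rule has separated the indices of complementary ones;
  every rule conclusion entails its premises, so that this is a model of the root.

  (2) Among the models of the root that vanish on the irrelevant variables choose one, \<open>J\<close>, whose
  values have the least sum. Every leaf true in \<open>J\<close> is unblocked, as a loop would yield a smaller
  model of the root. Following the leaves true in \<open>J\<close>, fairness forces rule applications until an
  irreducible leaf is reached, and this must happen: relative to \<open>J\<close> all iterations have fixed finite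
  lengths, so only finitely many propositional literals, hence finitely many instances of the closure
  rule, can occur, and every other rule decreases the total size of the iterations unfolded in \<open>J\<close>.\<close>

section \<open>Expressions and substitution\<close>

lemma leval_simps [simp]:
  "leval \<nu> (LVar n) = \<nu> n"
  "leval \<nu> 0 = 0"
  "leval \<nu> (LSuc a) = leval \<nu> a + 1"
  "leval \<nu> (a + b) = leval \<nu> a + leval \<nu> b"
  "leval \<nu> (a - b) = leval \<nu> a - leval \<nu> b"
  "leval \<nu> (lsubst i e a) = leval (\<nu>(i := leval \<nu> e)) a"
  by (transfer, simp add: tval_tsubst)+

lemma leval_lnum [simp]: "leval \<nu> (lnum k) = int k"
  by (induction k) (simp_all add: lnum_def)

lemma lvars_minus_lnum [simp]: "lvars (a - lnum k) = lvars a"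
  by (simp add: lvars_def)

lemma leval_upd_notin_lvars: "n \<notin> lvars a \<Longrightarrow> leval (\<nu>(n := k)) a = leval \<nu> a"
  by (auto simp: lvars_def)

text \<open>Occurrence in an expression is semantic, so the argument takes two valuations that
  witness dependence on \<open>n\<close> instead of an induction over terms.\<close>

lemma lvars_lsubst: "lvars (lsubst i e a) \<subseteq> lvars e \<union> (lvars a - {i})"
proof
  fix n assume "n \<in> lvars (lsubst i e a)"
  then obtain \<nu> k where neq: "leval ((\<nu>(n := k))(i := leval (\<nu>(n := k)) e)) a \<noteq>
      leval (\<nu>(i := leval \<nu> e)) a"
    by (auto simp: lvars_def)
  show "n \<in> lvars e \<union> (lvars a - {i})"
  proof (cases "n \<in> lvars e")
    case False
    then have eq: "leval (\<nu>(n := k)) e = leval \<nu> e"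
      by (rule leval_upd_notin_lvars)
    with neq have "n \<noteq> i" by auto
    with neq eq have "leval ((\<nu>(i := leval \<nu> e))(n := k)) a \<noteq> leval (\<nu>(i := leval \<nu> e)) a"
      by (simp add: fun_upd_twist)
    with \<open>n \<noteq> i\<close> show ?thesis using leval_upd_notin_lvars by blast
  qed simp
qed

lemma bound_vars_ssubst [simp]: "bound_vars (ssubst i e \<phi>) = bound_vars \<phi>"
  by (induction \<phi>) auto

lemma free_vars_ssubst: "free_vars (ssubst i e \<phi>) \<subseteq> lvars e \<union> (free_vars \<phi> - {i})"
proof (induction \<phi>)
  case (BigConj j a b \<phi>)
  then show ?case using lvars_lsubst[of i e a] lvars_lsubst[of i e b] by auto
next
  case (BigDisj j a b \<phi>)
  then show ?case using lvars_lsubst[of i e a] lvars_lsubst[of i e b] by auto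
next
  case (Less a b)
  then show ?case using lvars_lsubst[of i e a] lvars_lsubst[of i e b] by auto
next
  case (IProp p a)
  then show ?case using lvars_lsubst[of i e a] by auto
qed auto

lemma nnf_ssubst: "nnf \<phi> \<Longrightarrow> nnf (ssubst i e \<phi>)"
proof (induction \<phi>)
  case (Neg \<phi>)
  then show ?case by (cases \<phi>) auto
qed auto

text \<open>Without capture, an inner binder either is \<open>i\<close> itself and overrides the
  update, or does not occur in \<open>e\<close>, so that the two updates commute and the value of
  \<open>e\<close> is unaffected.\<close>

lemma holds_ssubst:
  assumes "lvars e \<inter> set (bound_vars \<phi>) = {}"
  shows "holds P \<nu> (ssubst i e \<phi>) = holds P (\<nu>(i := leval \<nu> e)) \<phi>"
  using assms
  by (induction \<phi> arbitrary: \<nu>) (auto simp: leval_upd_notin_lvars fun_upd_twist)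

lemma holds_arith: "is_arith \<phi> \<Longrightarrow> holds P \<nu> \<phi> = holds Q \<nu> \<phi>"
  by (induction \<phi>) auto

section \<open>Dependence of truth on finitely many variables\<close>

lemma leval_finite_support:
  "\<exists>V. finite V \<and> (\<forall>\<nu> \<nu>'. (\<forall>n\<in>V. \<nu> n = \<nu>' n) \<longrightarrow> leval \<nu> a = leval \<nu>' a)"
proof (transfer)
  \<comment> \<open>The syntactic variables of a representative term are finitely many and
    suffice.\<close>
  fix t
  show "\<exists>V. finite V \<and> (\<forall>\<nu> \<nu>'. (\<forall>n\<in>V. \<nu> n = \<nu>' n) \<longrightarrow> tval \<nu> t = tval \<nu>' t)"
  proof (induction t)
    case (TVar n)
    show ?case by (rule exI[of _ "{n}"]) simp
  next
    case (TPlus s t)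
    then obtain V W where V: "finite V" "\<And>\<nu> \<nu>'. (\<forall>n\<in>V. \<nu> n = \<nu>' n) \<Longrightarrow> tval \<nu> s = tval \<nu>' s"
      and W: "finite W" "\<And>\<nu> \<nu>'. (\<forall>n\<in>W. \<nu> n = \<nu>' n) \<Longrightarrow> tval \<nu> t = tval \<nu>' t"
      by auto
    show ?case
      by (rule exI[of _ "V \<union> W"], intro conjI allI impI)
        (use V(1) W(1) in simp, simp, metis UnI1 UnI2 V(2) W(2))
  next
    case (TMinus s t)
    then obtain V W where V: "finite V" "\<And>\<nu> \<nu>'. (\<forall>n\<in>V. \<nu> n = \<nu>' n) \<Longrightarrow> tval \<nu> s = tval \<nu>' s"
      and W: "finite W" "\<And>\<nu> \<nu>'. (\<forall>n\<in>W. \<nu> n = \<nu>' n) \<Longrightarrow> tval \<nu> t = tval \<nu>' t"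
      by auto
    show ?case
      by (rule exI[of _ "V \<union> W"], intro conjI allI impI)
        (use V(1) W(1) in simp, simp, metis UnI1 UnI2 V(2) W(2))
  qed auto
qed

text \<open>A semantic substitute for containing the free variables; being upward closed, it lets
  the supports of subschemata be united.\<close>

definition supports :: "avar set \<Rightarrow> schema \<Rightarrow> bool" where
  "supports V \<phi> \<longleftrightarrow> (\<forall>P \<nu> \<nu>'. (\<forall>n\<in>V. \<nu> n = \<nu>' n) \<longrightarrow> holds P \<nu> \<phi> = holds P \<nu>' \<phi>)"

lemma supports_mono: "supports V \<phi> \<Longrightarrow> V \<subseteq> W \<Longrightarrow> supports W \<phi>"
  unfolding supports_def by blast

lemma supportsD: "supports V \<phi> \<Longrightarrow> \<forall>n\<in>V. \<nu> n = \<nu>' n \<Longrightarrow> holds P \<nu> \<phi> = holds P \<nu>' \<phi>"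
  unfolding supports_def by blast

lemma finite_support: "\<exists>V. finite V \<and> supports V \<phi>"
proof -
  obtain F :: "lexp \<Rightarrow> avar set" where F: "\<And>a. finite (F a)"
    and leval_F: "\<And>a \<nu> \<nu>'. \<forall>n\<in>F a. \<nu> n = \<nu>' n \<Longrightarrow> leval \<nu> a = leval \<nu>' a"
    using leval_finite_support by metis
  \<comment> \<open>The iteration variable may stay in \<open>V\<close>: both assignments give it
    the same value \<alpha>, so they still agree on \<open>V\<close>.\<close>
  have iter: "(\<forall>n\<in>F a \<union> F b \<union> V. \<nu> n = \<nu>' n) \<Longrightarrow> supports V \<phi> \<Longrightarrow>
      leval \<nu> a = leval \<nu>' a \<and> leval \<nu> b = leval \<nu>' b \<and>
      (\<forall>P \<alpha>. holds P (\<nu>(i := \<alpha>)) \<phi> = holds P (\<nu>'(i := \<alpha>)) \<phi>)" for a b V \<nu> \<nu>' \<phi> i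
    by (intro conjI allI leval_F supportsD[of V]) auto
  show ?thesis
  proof (induction \<phi>)
    case (Less a b)
    have "supports (F a \<union> F b) (Less a b)"
      unfolding supports_def by (auto simp: leval_F[of a] leval_F[of b] ball_Un)
        (metis leval_F)+
    then show ?case using F by blast
  next
    case (IProp p a)
    have "supports (F a) (IProp p a)"
      unfolding supports_def by (metis holds.simps(4) leval_F)
    then show ?case using F by blast
  next
    case (Conj \<phi> \<psi>)
    then obtain V W where "finite V" "supports V \<phi>" "finite W" "supports W \<psi>" by auto
    then have "finite (V \<union> W)" "supports (V \<union> W) \<phi>" "supports (V \<union> W) \<psi>"
      by (auto intro: supports_mono)
    then show ?case unfolding supports_def by (metis holds.simps(6))
  next
    case (Disj \<phi> \<psi>)
    then obtain V W where "finite V" "supports V \<phi>" "finite W" "supports W \<psi>" by auto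
    then have "finite (V \<union> W)" "supports (V \<union> W) \<phi>" "supports (V \<union> W) \<psi>"
      by (auto intro: supports_mono)
    then show ?case unfolding supports_def by (metis holds.simps(7))
  next
    case (BigConj i a b \<phi>)
    then obtain V where V: "finite V" "supports V \<phi>" by auto
    have "supports (F a \<union> F b \<union> V) (BigConj i a b \<phi>)"
      unfolding supports_def
    proof (intro allI impI)
      fix P and \<nu> \<nu>' :: "avar \<Rightarrow> int"
      assume "\<forall>n\<in>F a \<union> F b \<union> V. \<nu> n = \<nu>' n"
      from iter[OF this V(2), of i]
      show "holds P \<nu> (BigConj i a b \<phi>) = holds P \<nu>' (BigConj i a b \<phi>)" by simp
    qed
    then show ?case using F V by (metis finite_UnI)
  next
    case (BigDisj i a b \<phi>)
    then obtain V where V: "finite V" "supports V \<phi>" by auto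
    have "supports (F a \<union> F b \<union> V) (BigDisj i a b \<phi>)"
      unfolding supports_def
    proof (intro allI impI)
      fix P and \<nu> \<nu>' :: "avar \<Rightarrow> int"
      assume "\<forall>n\<in>F a \<union> F b \<union> V. \<nu> n = \<nu>' n"
      from iter[OF this V(2), of i]
      show "holds P \<nu> (BigDisj i a b \<phi>) = holds P \<nu>' (BigDisj i a b \<phi>)" by simp
    qed
    then show ?case using F V by (metis finite_UnI)
  qed (auto simp: supports_def)
qed


section \<open>Extension rules\<close>

text \<open>The fragment of \<open>wf_schema\<close> kept as an invariant of the rules: unfolding
  may duplicate iterations inside a body, which destroys distinctness of the bound variables but not
  their disjointness from the free ones.\<close>

definition regular :: "schema \<Rightarrow> bool" where
  "regular \<phi> \<longleftrightarrow> nnf \<phi> \<and> free_vars \<phi> \<inter> set (bound_vars \<phi>) = {}"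

lemma wf_schema_regular: "wf_schema \<phi> \<Longrightarrow> regular \<phi>"
  by (auto simp: wf_schema_def regular_def)

text \<open>The variables of the upper bound are free in the whole iteration, hence never bound in
  its body.\<close>

lemma regular_no_capture:
  "regular (BigConj i a b \<phi>) \<Longrightarrow> lvars b \<inter> set (bound_vars \<phi>) = {}"
  "regular (BigDisj i a b \<phi>) \<Longrightarrow> lvars b \<inter> set (bound_vars \<phi>) = {}"
  by (auto simp: regular_def)

text \<open>Replacing \<open>i\<close> by \<open>b\<close> adds only variables already free in the
  iteration, and the set of bound variables does not change.\<close>

lemma regular_unfold:
  "regular (BigConj i a b \<phi>) \<Longrightarrow> regular (Conj (BigConj i a (b - lnum 1) \<phi>) (ssubst i b \<phi>))"
  "regular (BigDisj i a b \<phi>) \<Longrightarrow> regular (Disj (BigDisj i a (b - lnum 1) \<phi>) (ssubst i b \<phi>))"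
proof -
  assume "regular (BigConj i a b \<phi>)"
  moreover have "free_vars (Conj (BigConj i a (b - lnum 1) \<phi>) (ssubst i b \<phi>)) \<subseteq>
      free_vars (BigConj i a b \<phi>)"
    using free_vars_ssubst[of i b \<phi>] by (simp del: One_nat_def) blast
  moreover have "set (bound_vars (Conj (BigConj i a (b - lnum 1) \<phi>) (ssubst i b \<phi>))) =
      set (bound_vars (BigConj i a b \<phi>))" by simp
  ultimately show "regular (Conj (BigConj i a (b - lnum 1) \<phi>) (ssubst i b \<phi>))"
    unfolding regular_def using nnf_ssubst[of \<phi> i b] by (metis nnf.simps(6,8) disjoint_iff subsetD)
next
  assume "regular (BigDisj i a b \<phi>)"
  moreover have "free_vars (Disj (BigDisj i a (b - lnum 1) \<phi>) (ssubst i b \<phi>)) \<subseteq>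
      free_vars (BigDisj i a b \<phi>)"
    using free_vars_ssubst[of i b \<phi>] by (simp del: One_nat_def) blast
  moreover have "set (bound_vars (Disj (BigDisj i a (b - lnum 1) \<phi>) (ssubst i b \<phi>))) =
      set (bound_vars (BigDisj i a b \<phi>))" by simp
  ultimately show "regular (Disj (BigDisj i a (b - lnum 1) \<phi>) (ssubst i b \<phi>))"
    unfolding regular_def using nnf_ssubst[of \<phi> i b] by (metis nnf.simps(7,9) disjoint_iff subsetD)
qed

lemma regular_arith: "nnf \<phi> \<Longrightarrow> is_arith \<phi> \<Longrightarrow> regular \<phi>"
proof -
  have "is_arith \<phi> \<Longrightarrow> bound_vars \<phi> = []" by (induction \<phi>) auto
  then show "nnf \<phi> \<Longrightarrow> is_arith \<phi> \<Longrightarrow> regular \<phi>" by (simp add: regular_def)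
qed

lemma ext_rule_regular:
  assumes "ext_rule B P Cs" "\<forall>\<phi>\<in>P. regular \<phi>" "C \<in> set Cs" "\<psi> \<in> C"
  shows "regular \<psi>"
  using assms
proof cases
  case (iterated_and i a b \<phi>)
  then show ?thesis
    using assms regular_unfold(1)[of i a b \<phi>] by (auto simp: Geq_def intro: regular_arith)
next
  case (iterated_or i a b \<phi>)
  then show ?thesis
    using assms regular_unfold(2)[of i a b \<phi>] by (auto simp: Geq_def intro: regular_arith)
qed (auto simp: regular_def Neq_def)

section \<open>Unfolding of iterations and soundness of the rules\<close>

lemma atLeastAtMost_unfold:
  "leval \<nu> a \<le> leval \<nu> b \<Longrightarrow>
    {leval \<nu> a..leval \<nu> b} = insert (leval \<nu> b) {leval \<nu> a..leval \<nu> b - 1}"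
  by auto

text \<open>The interval must be nonempty: on an empty one the iteration is true, while the
  unfolding still asserts the instance at \<open>b\<close>.\<close>

lemma holds_BigConj_unfold:
  assumes "lvars b \<inter> set (bound_vars \<phi>) = {}" "leval \<nu> a \<le> leval \<nu> b"
  shows "holds P \<nu> (Conj (BigConj i a (b - lnum 1) \<phi>) (ssubst i b \<phi>)) =
    holds P \<nu> (BigConj i a b \<phi>)"
proof -
  have "holds P \<nu> (BigConj i a b \<phi>) =
      (\<forall>\<alpha>\<in>{leval \<nu> a..leval \<nu> b}. holds P (\<nu>(i := \<alpha>)) \<phi>)" by auto
  then show ?thesis
    unfolding atLeastAtMost_unfold[OF assms(2)] by (auto simp: holds_ssubst[OF assms(1)])
qed

lemma holds_BigDisj_unfold:
  assumes "lvars b \<inter> set (bound_vars \<phi>) = {}" "leval \<nu> a \<le> leval \<nu> b"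
  shows "holds P \<nu> (Disj (BigDisj i a (b - lnum 1) \<phi>) (ssubst i b \<phi>)) =
    holds P \<nu> (BigDisj i a b \<phi>)"
proof -
  have "holds P \<nu> (BigDisj i a b \<phi>) =
      (\<exists>\<alpha>\<in>{leval \<nu> a..leval \<nu> b}. holds P (\<nu>(i := \<alpha>)) \<phi>)" by auto
  then show ?thesis
    unfolding atLeastAtMost_unfold[OF assms(2)] by (auto simp: holds_ssubst[OF assms(1)])
qed

lemma models_simps [simp]:
  "models J (Less a b) \<longleftrightarrow> ieval J a < ieval J b"
  "models J (Geq b a) \<longleftrightarrow> ieval J a \<le> ieval J b"
  "models J (Neq a b) \<longleftrightarrow> ieval J a \<noteq> ieval J b"
  "models J (IProp p a) \<longleftrightarrow> pint J p (ieval J a)"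
  "models J (Neg \<phi>) \<longleftrightarrow> \<not> models J \<phi>"
  "models J (Conj \<phi> \<psi>) \<longleftrightarrow> models J \<phi> \<and> models J \<psi>"
  "models J (Disj \<phi> \<psi>) \<longleftrightarrow> models J \<phi> \<or> models J \<psi>"
  by (auto simp: models_def ieval_def Geq_def Neq_def)

lemma models_BigConj_unfold:
  assumes "regular (BigConj i a b \<phi>)" "ieval J a \<le> ieval J b"
  shows "models J (Conj (BigConj i a (b - lnum 1) \<phi>) (ssubst i b \<phi>)) \<longleftrightarrow>
    models J (BigConj i a b \<phi>)"
  using holds_BigConj_unfold[OF regular_no_capture(1)[OF assms(1)]] assms(2)
  unfolding models_def ieval_def by blast

lemma models_BigDisj_unfold:
  assumes "regular (BigDisj i a b \<phi>)" "ieval J a \<le> ieval J b"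
  shows "models J (Disj (BigDisj i a (b - lnum 1) \<phi>) (ssubst i b \<phi>)) \<longleftrightarrow>
    models J (BigDisj i a b \<phi>)"
  using holds_BigDisj_unfold[OF regular_no_capture(2)[OF assms(1)]] assms(2)
  unfolding models_def ieval_def by blast

lemma models_BigConj_empty: "ieval J b < ieval J a \<Longrightarrow> models J (BigConj i a b \<phi>)"
  by (auto simp: models_def ieval_def)

lemma models_BigDisj_nonempty: "models J (BigDisj i a b \<phi>) \<Longrightarrow> ieval J a \<le> ieval J b"
  by (auto simp: models_def ieval_def)

text \<open>The constraint carried by a conclusion of an iteration rule selects the nonempty case,
  where unfolding is an equivalence, or the empty one, where the iterated conjunction is trivially
  true. This carries models towards the root.\<close>

lemma ext_rule_conclusion_entails:
  assumes "ext_rule B P Cs" "\<forall>\<phi>\<in>P. regular \<phi>" "C \<in> set Cs" "models_set J C"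
  shows "models_set J P"
  using assms(1)
proof cases
  case (iterated_and i a b \<phi>)
  then show ?thesis
    using assms models_BigConj_unfold[of i a b \<phi> J] models_BigConj_empty[of J b a i \<phi>]
    by (auto simp: models_set_def)
next
  case (iterated_or i a b \<phi>)
  then show ?thesis
    using assms models_BigDisj_unfold[of i a b \<phi> J] by (auto simp: models_set_def)
qed (use assms in \<open>auto simp: models_set_def\<close>)

text \<open>This carries models towards the leaves. A true iterated disjunction has a nonempty
  interval, and true \<open>p_a\<close> and \<open>\<not> p_b\<close> force different indices, so a
  single conclusion suffices in both cases.\<close>

lemma ext_rule_sound:
  assumes "ext_rule B P Cs" "\<forall>\<phi>\<in>P. regular \<phi>" "models_set J P"
  shows "\<exists>C\<in>set Cs. models_set J C"
  using assms(1)
proof cases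
  case (iterated_and i a b \<phi>)
  then show ?thesis
    using assms models_BigConj_unfold[of i a b \<phi> J]
    by (cases "ieval J a \<le> ieval J b") (auto simp: models_set_def)
next
  case (iterated_or i a b \<phi>)
  then show ?thesis
    using assms models_BigDisj_unfold[of i a b \<phi> J] models_BigDisj_nonempty[of J i a b \<phi>]
    by (auto simp: models_set_def)
next
  case (closure a b p)
  then show ?thesis using assms(3) by (auto simp: models_set_def)
qed (use assms in \<open>auto simp: models_set_def\<close>)

abbreviation arith_part :: "schema set \<Rightarrow> schema set" where
  "arith_part \<Phi> \<equiv> {\<phi> \<in> \<Phi>. is_arith \<phi>}"

text \<open>An arithmetic premise is a conjunction or disjunction, whose components stay arithmetic
  in the conclusions; iterations and propositional literals contribute nothing.\<close>

lemma ext_rule_arith_entails: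
  assumes "ext_rule B P Cs" "C \<in> set Cs" "models_set J (arith_part C)"
  shows "models_set J (arith_part P)"
  using assms by cases (auto simp: models_set_def)


section \<open>Tableaux generated by the rules\<close>

text \<open>Each node is justified by its parent alone. The branch \<open>B\<close> is left
  arbitrary because the properties transferred along edges do not depend on it.\<close>

definition rule_tree :: "schema set \<Rightarrow> tableau \<Rightarrow> bool" where
  "rule_tree \<Phi> T \<longleftrightarrow> T [] = Some \<Phi> \<and>
     (\<forall>N k. N @ [k] \<in> nodes T \<longrightarrow> N \<in> nodes T \<and>
       (\<exists>B P Cs. ext_rule B P Cs \<and> P \<subseteq> label T N \<and> k < length Cs \<and>
          label T (N @ [k]) = Cs ! k \<union> (label T N - P)))"

lemma rule_tree_child:
  assumes "rule_tree \<Phi> T" "N @ [k] \<in> nodes T"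
  obtains B P Cs where "N \<in> nodes T" "ext_rule B P Cs" "P \<subseteq> label T N" "Cs ! k \<in> set Cs"
    "label T (N @ [k]) = Cs ! k \<union> (label T N - P)"
  using assms unfolding rule_tree_def by (meson nth_mem)

lemma rule_tree_label_root: "rule_tree \<Phi> T \<Longrightarrow> label T [] = \<Phi>"
  by (simp add: rule_tree_def label_def)

lemma extend_child: "k < length Cs \<Longrightarrow> extend T N P Cs (N @ [k]) = Some (Cs ! k \<union> (label T N - P))"
  by (simp add: extend_def)

text \<open>Since \<open>N\<close> is a leaf, the addresses of its new children are fresh and
  overwrite nothing.\<close>

lemma extend_other:
  assumes "N \<in> leaves T" "M \<in> nodes T"
  shows "extend T N P Cs M = T M"
  using assms by (auto simp: extend_def leaves_def)

lemma rule_applied_persistent: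
  "rule_applied T N T' \<Longrightarrow> M \<in> nodes T \<Longrightarrow> T' M = T M"
  by (auto simp: rule_applied_def extend_other)

lemma rule_tree_rule_applied:
  assumes "rule_tree \<Phi> T" "rule_applied T N T'"
  shows "rule_tree \<Phi> T'"
proof -
  obtain P Cs where N: "N \<in> leaves T" and rule: "ext_rule (branch_schemata T N) P Cs"
    and P: "P \<subseteq> label T N" and T': "T' = extend T N P Cs"
    using assms(2) unfolding rule_applied_def by blast
  have pers: "T' M = T M" "label T' M = label T M" "M \<in> nodes T'" if "M \<in> nodes T" for M
    using that extend_other[OF N that] by (simp_all add: T' label_def nodes_def domIff)
  have root: "[] \<in> nodes T" using assms(1) by (auto simp: rule_tree_def nodes_def)
  show ?thesis unfolding rule_tree_def
  proof (intro conjI allI impI)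
    show "T' [] = Some \<Phi>" using pers(1)[OF root] assms(1) by (simp add: rule_tree_def)
  next
    fix M k assume M: "M @ [k] \<in> nodes T'"
    have *: "M \<in> nodes T \<and> (\<exists>B P Cs. ext_rule B P Cs \<and> P \<subseteq> label T M \<and> k < length Cs \<and>
        label T' (M @ [k]) = Cs ! k \<union> (label T M - P))"
    proof (cases "M @ [k] \<in> nodes T")
      case True
      then show ?thesis using assms(1) pers(2)[OF True] unfolding rule_tree_def by simp
    next
      case False
      then have "M = N \<and> k < length Cs"
        using M by (auto simp: T' extend_def nodes_def split: if_splits)
      then show ?thesis
        using N rule P extend_child[of k Cs T N P]
        by (auto simp: T' leaves_def label_def[of "extend T N P Cs"])
    qed
    then show "M \<in> nodes T'"
      "\<exists>B P Cs. ext_rule B P Cs \<and> P \<subseteq> label T' M \<and> k < length Cs \<and>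
        label T' (M @ [k]) = Cs ! k \<union> (label T' M - P)"
      using pers by simp_all
  qed
qed

lemma rule_tree_regular:
  assumes "rule_tree \<Phi> T" "\<forall>\<phi>\<in>\<Phi>. regular \<phi>"
  shows "N \<in> nodes T \<Longrightarrow> \<forall>\<phi>\<in>label T N. regular \<phi>"
proof (induction N rule: rev_induct)
  case Nil
  then show ?case using assms rule_tree_label_root by simp
next
  case (snoc k N)
  from rule_tree_child[OF assms(1) snoc.prems] show ?case
    by (metis snoc.IH ext_rule_regular DiffE UnE subsetD)
qed

text \<open>Going up one edge, the removed premises follow from the conclusion and the rest of the
  label was copied. Inner nodes are covered as well, because a loop may point to one.\<close>

lemma rule_tree_models_root:
  assumes "rule_tree \<Phi> T" "\<forall>\<phi>\<in>\<Phi>. regular \<phi>"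
  shows "N \<in> nodes T \<Longrightarrow> models_set J (label T N) \<Longrightarrow> models_set J \<Phi>"
proof (induction N rule: rev_induct)
  case Nil
  then show ?case using rule_tree_label_root[OF assms(1)] by simp
next
  case (snoc k N)
  obtain B P Cs where N: "N \<in> nodes T" and rule: "ext_rule B P Cs" and P: "P \<subseteq> label T N"
    and C: "Cs ! k \<in> set Cs" and lab: "label T (N @ [k]) = Cs ! k \<union> (label T N - P)"
    using rule_tree_child[OF assms(1) snoc.prems(1)] .
  have "models_set J P"
    using ext_rule_conclusion_entails[OF rule _ C] rule_tree_regular[OF assms N] P snoc.prems(2)
    by (auto simp: lab models_set_def)
  then have "models_set J (label T N)"
    using snoc.prems(2) by (auto simp: lab models_set_def)
  then show ?case using snoc.IH N by blast
qed

text \<open>A disequation is a disjunction and may have been decomposed below the node where it was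
  introduced; its truth is nevertheless recovered from the arithmetic formulae that remain.\<close>

lemma rule_tree_models_arith_prefix:
  assumes "rule_tree \<Phi> T"
  shows "N \<in> nodes T \<Longrightarrow> models_set J (arith_part (label T N)) \<Longrightarrow> prefix M N \<Longrightarrow>
    models_set J (arith_part (label T M))"
proof (induction N rule: rev_induct)
  case (snoc k N)
  obtain B P Cs where N: "N \<in> nodes T" and rule: "ext_rule B P Cs" and P: "P \<subseteq> label T N"
    and C: "Cs ! k \<in> set Cs" and lab: "label T (N @ [k]) = Cs ! k \<union> (label T N - P)"
    using rule_tree_child[OF assms snoc.prems(1)] .
  have "models_set J (arith_part P)"
    using ext_rule_arith_entails[OF rule C] snoc.prems(2) by (auto simp: lab models_set_def)
  then have "models_set J (arith_part (label T N))"
    using snoc.prems(2) by (auto simp: lab models_set_def)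
  then show ?case using snoc N by (auto simp: prefix_snoc)
qed simp

section \<open>Invariants along a derivation\<close>

lemma derivation_rule_tree:
  assumes "derivation I T"
  obtains \<Phi> where "\<forall>\<phi>\<in>\<Phi>. regular \<phi>" "T 0 = [[] \<mapsto> \<Phi>]" "\<And>\<iota>. \<iota> \<in> I \<Longrightarrow> rule_tree \<Phi> (T \<iota>)"
proof -
  obtain \<Phi> where \<Phi>: "\<forall>\<phi>\<in>\<Phi>. wf_schema \<phi>" "T 0 = [[] \<mapsto> \<Phi>]"
    using assms unfolding derivation_def by blast
  have "\<iota> \<in> I \<longrightarrow> rule_tree \<Phi> (T \<iota>)" for \<iota>
  proof (induction \<iota>)
    case 0
    show ?case by (auto simp: \<Phi>(2) rule_tree_def nodes_def)
  next
    case (Suc \<iota>)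
    show ?case
    proof
      assume *: "Suc \<iota> \<in> I"
      have "\<iota> \<in> I" using assms * unfolding derivation_def by auto
      moreover obtain N where "rule_applied (T \<iota>) N (T (Suc \<iota>))"
        using assms * unfolding derivation_def by fastforce
      ultimately show "rule_tree \<Phi> (T (Suc \<iota>))"
        using Suc rule_tree_rule_applied by blast
    qed
  qed
  then show thesis using that[of \<Phi>] \<Phi> wf_schema_regular by blast
qed

lemma derivation_downward: "derivation I T \<Longrightarrow> \<iota> \<in> I \<Longrightarrow> \<kappa> \<le> \<iota> \<Longrightarrow> \<kappa> \<in> I"
  unfolding derivation_def by auto

text \<open>Fairness may postpone the rule on a leaf; its label and its ancestors are still the same
  when the rule comes.\<close>

lemma derivation_persistent:
  assumes "derivation I T"
  shows "\<mu> \<in> I \<Longrightarrow> \<iota> \<le> \<mu> \<Longrightarrow> N \<in> nodes (T \<iota>) \<Longrightarrow> T \<mu> N = T \<iota> N"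
proof (induction \<mu>)
  case (Suc \<mu>)
  show ?case
  proof (cases "\<iota> \<le> \<mu>")
    case True
    have "\<mu> \<in> I" using derivation_downward[OF assms Suc.prems(1)] by simp
    with Suc True have eq: "T \<mu> N = T \<iota> N" by blast
    obtain M where "rule_applied (T \<mu>) M (T (Suc \<mu>))"
      using assms Suc.prems(1) unfolding derivation_def by fastforce
    moreover have "N \<in> nodes (T \<mu>)" using eq Suc.prems(3) by (auto simp: nodes_def)
    ultimately show ?thesis using eq rule_applied_persistent by metis
  next
    case False
    then have "\<iota> = Suc \<mu>" using Suc.prems(2) by simp
    then show ?thesis by simp
  qed
qed simp


section \<open>Irreducible leaves\<close>

lemma irreducible_leaf_satisfiable:
  assumes tree: "rule_tree \<Phi> T" "\<forall>\<phi>\<in>\<Phi>. regular \<phi>"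
    and irred: "irreducible_leaf T N" and open_leaf: "\<not> closed_leaf T N"
  shows "\<exists>J. models_set J (label T N)"
proof -
  have leaf: "N \<in> leaves T" using irred by (simp add: irreducible_leaf_def)
  then have N: "N \<in> nodes T" by (simp add: leaves_def)
  obtain K where K: "models_set K (arith_part (label T N))"
    using open_leaf leaf unfolding closed_leaf_def by blast
  have no_rule: "\<not> P \<subseteq> label T N" if "ext_rule (branch_schemata T N) P Cs" for P Cs
    using irred that unfolding irreducible_leaf_def rule_applied_def by blast
  \<comment> \<open>The arithmetic values come from \<open>K\<close>; exactly the propositional
    variables denoted by positive literals of the label are made true.\<close>
  define J where "J = Interp (aint K) (\<lambda>p k. \<exists>a. IProp p a \<in> label T N \<and> ieval K a = k)"
  have ieval: "ieval J a = ieval K a" for a by (simp add: J_def ieval_def)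
  have arith: "models J \<phi>" if "\<phi> \<in> label T N" "is_arith \<phi>" for \<phi>
  proof -
    have "models K \<phi>" using K that by (simp add: models_set_def)
    then show ?thesis using holds_arith[OF that(2), of "pint K" _ "pint J"]
      by (simp add: models_def J_def)
  qed
  have "models J \<phi>" if \<phi>: "\<phi> \<in> label T N" for \<phi>
  proof -
    have "nnf \<phi>" using rule_tree_regular[OF tree N] \<phi> by (simp add: regular_def)
    show ?thesis
    proof (cases \<phi>)
      case (IProp p a)
      then show ?thesis using \<phi> by (auto simp: ieval) (auto simp: J_def)
    next
      case (Neg \<psi>)
      show ?thesis
      proof (cases "is_arith \<psi>")
        case True
        then show ?thesis using arith[OF \<phi>] Neg by simp
      next
        case False
        then obtain p b where \<psi>: "\<psi> = IProp p b"
          using \<open>nnf \<phi>\<close> Neg by (cases \<psi>) auto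
        have False if a: "IProp p a \<in> label T N" "ieval K a = ieval K b" for a
        proof -
          \<comment> \<open>Closure is applicable to the two literals unless its disequation already
            occurs on the branch. An equivalent of it then sits at some ancestor and is true in
            \<open>K\<close>, against the equality of the indices.\<close>
          have "occurs_upto (branch_schemata T N) (Neq a b)"
            using no_rule closure a(1) \<phi> Neg \<psi> by fastforce
          then obtain \<chi> M where \<chi>: "\<chi> \<in> label T M" "prefix M N" "is_arith \<chi>"
            and equiv: "sem_equiv \<chi> (Neq a b)"
            unfolding occurs_upto_def branch_schemata_def by blast
          have "models K \<chi>"
            using rule_tree_models_arith_prefix[OF tree(1) N K \<chi>(2)] \<chi> by (simp add: models_set_def)
          then have "models K (Neq a b)" using equiv by (simp add: sem_equiv_def)
          then show False using a(2) by simp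
        qed
        then show ?thesis by (auto simp: Neg \<psi> ieval) (auto simp: J_def)
      qed
    next
      case (Conj \<psi> \<chi>)
      then show ?thesis using \<phi> no_rule[OF and_rule] by simp
    next
      case (Disj \<psi> \<chi>)
      then show ?thesis using \<phi> no_rule[OF or_rule] by simp
    next
      case (BigConj i a b \<psi>)
      then show ?thesis using \<phi> no_rule[OF iterated_and] by simp
    next
      case (BigDisj i a b \<psi>)
      then show ?thesis using \<phi> no_rule[OF iterated_or] by simp
    qed (use arith[OF \<phi>] in auto)
  qed
  then show ?thesis by (auto simp: models_set_def)
qed


section \<open>Termination along a fixed interpretation\<close>

text \<open>The constants make every decomposition strictly decreasing: 3 per instance pays for the
  new connective and the bound constraint with one unit to spare, and 2 for the iteration exceeds
  the weight 1 of \<open>Less b a\<close> left by an empty interval.\<close>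

primrec weight :: "(avar \<Rightarrow> int) \<Rightarrow> schema \<Rightarrow> nat" where
  "weight \<nu> Top = 1"
| "weight \<nu> Bot = 1"
| "weight \<nu> (Less a b) = 1"
| "weight \<nu> (IProp p a) = 1"
| "weight \<nu> (Neg \<phi>) = 1"
| "weight \<nu> (Conj \<phi> \<psi>) = 1 + weight \<nu> \<phi> + weight \<nu> \<psi>"
| "weight \<nu> (Disj \<phi> \<psi>) = 1 + weight \<nu> \<phi> + weight \<nu> \<psi>"
| "weight \<nu> (BigConj i a b \<phi>) =
     2 + (\<Sum>\<alpha>\<in>{leval \<nu> a..leval \<nu> b}. 3 + weight (\<nu>(i := \<alpha>)) \<phi>)"
| "weight \<nu> (BigDisj i a b \<phi>) =
     2 + (\<Sum>\<alpha>\<in>{leval \<nu> a..leval \<nu> b}. 3 + weight (\<nu>(i := \<alpha>)) \<phi>)"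

text \<open>Identifies the weight of the instance split off by unfolding with the weight of the body
  in the last summand of the iteration.\<close>

lemma weight_ssubst:
  assumes "lvars e \<inter> set (bound_vars \<phi>) = {}"
  shows "weight \<nu> (ssubst i e \<phi>) = weight (\<nu>(i := leval \<nu> e)) \<phi>"
  using assms
proof (induction \<phi> arbitrary: \<nu>)
  case (BigConj j a b \<phi>)
  then show ?case
    by (cases "j = i") (simp_all add: leval_upd_notin_lvars fun_upd_twist del: fun_upd_apply)
next
  case (BigDisj j a b \<phi>)
  then show ?case
    by (cases "j = i") (simp_all add: leval_upd_notin_lvars fun_upd_twist del: fun_upd_apply)
qed (simp_all add: Int_Un_distrib)

definition iweight :: "interp \<Rightarrow> schema \<Rightarrow> nat" where
  "iweight J \<phi> = weight (\<lambda>n. int (aint J n)) \<phi>"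

text \<open>The schemata that the rules other than closure can put in place of \<open>\<phi>\<close> on a branch
  true in \<open>J\<close>.\<close>

fun components :: "interp \<Rightarrow> schema \<Rightarrow> schema set" where
  "components J (Conj \<phi> \<psi>) = {\<phi>, \<psi>}"
| "components J (Disj \<phi> \<psi>) = {\<phi>, \<psi>}"
| "components J (BigConj i a b \<phi>) =
     (if ieval J a \<le> ieval J b
      then {Conj (BigConj i a (b - lnum 1) \<phi>) (ssubst i b \<phi>), Geq b a} else {Less b a})"
| "components J (BigDisj i a b \<phi>) =
     (if ieval J a \<le> ieval J b
      then {Disj (BigDisj i a (b - lnum 1) \<phi>) (ssubst i b \<phi>), Geq b a} else {})"
| "components J _ = {}"

lemma finite_components: "finite (components J \<phi>)"
  by (cases "(J, \<phi>)" rule: components.cases) auto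

lemma components_regular: "regular \<phi> \<Longrightarrow> \<psi> \<in> components J \<phi> \<Longrightarrow> regular \<psi>"
proof (cases \<phi>)
  case (BigConj i a b \<chi>)
  assume "regular \<phi>" "\<psi> \<in> components J \<phi>"
  then show ?thesis using regular_unfold(1)[of i a b \<chi>] BigConj
    by (auto simp: Geq_def intro: regular_arith split: if_splits)
next
  case (BigDisj i a b \<chi>)
  assume "regular \<phi>" "\<psi> \<in> components J \<phi>"
  then show ?thesis using regular_unfold(2)[of i a b \<chi>] BigDisj
    by (auto simp: Geq_def intro: regular_arith split: if_splits)
qed (auto simp: regular_def)

lemma components_arith: "is_arith \<phi> \<Longrightarrow> \<psi> \<in> components J \<phi> \<Longrightarrow> is_arith \<psi>"
  by (cases \<phi>) auto

lemma sum_insert_le: "finite A \<Longrightarrow> sum f (insert x A) \<le> (f x + sum f A :: nat)"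
  by (cases "x \<in> A") (auto simp: insert_absorb)

lemma iweight_components:
  assumes "regular \<phi>"
  shows "sum (iweight J) (components J \<phi>) < iweight J \<phi>"
proof -
  \<comment> \<open>Only an inequality, as the two schemata may coincide.\<close>
  have two: "sum (iweight J) {\<psi>, \<chi>} \<le> iweight J \<psi> + iweight J \<chi>" for \<psi> \<chi>
    using sum_insert_le[of "{\<chi>}" "iweight J" \<psi>] by simp
  let ?\<nu> = "\<lambda>n. int (aint J n)"
  show ?thesis
  proof (cases \<phi>)
    case (Conj \<psi> \<chi>)
    then show ?thesis using two[of \<psi> \<chi>] by (simp add: iweight_def)
  next
    case (Disj \<psi> \<chi>)
    then show ?thesis using two[of \<psi> \<chi>] by (simp add: iweight_def)
  next
    case (BigConj i a b \<psi>)
    show ?thesis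
    proof (cases "ieval J a \<le> ieval J b")
      case True
      \<comment> \<open>Let S be the sum over the interval without its upper end and w the weight of
        the instance at \<open>b\<close>: the iteration weighs 5 + S + w, its components at most 4 +
        S + w.\<close>
      then show ?thesis
        using two[of "Conj (BigConj i a (b - lnum 1) \<psi>) (ssubst i b \<psi>)" "Geq b a"] assms
        by (simp add: BigConj iweight_def ieval_def Geq_def atLeastAtMost_unfold
            weight_ssubst regular_no_capture(1)[of i a b \<psi>])
    next
      case False
      then show ?thesis by (simp add: BigConj iweight_def)
    qed
  next
    case (BigDisj i a b \<psi>)
    show ?thesis
    proof (cases "ieval J a \<le> ieval J b")
      case True
      then show ?thesis
        using two[of "Disj (BigDisj i a (b - lnum 1) \<psi>) (ssubst i b \<psi>)" "Geq b a"] assms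
        by (simp add: BigDisj iweight_def ieval_def Geq_def atLeastAtMost_unfold
            weight_ssubst regular_no_capture(2)[of i a b \<psi>])
    next
      case False
      then show ?thesis by (simp add: BigDisj iweight_def)
    qed
  qed (simp_all add: iweight_def)
qed

lemma iweight_component_less:
  assumes "regular \<phi>" "\<psi> \<in> components J \<phi>"
  shows "iweight J \<psi> < iweight J \<phi>"
proof -
  have "iweight J \<psi> \<le> sum (iweight J) (components J \<phi>)"
    using assms(2) finite_components by (simp add: member_le_sum)
  then show ?thesis using iweight_components[of \<phi> J] assms(1) by simp
qed

text \<open>The disequations added by closure are not collected here; of them only
  \<open>is_arith\<close> is recorded.\<close>

inductive_set descendants :: "interp \<Rightarrow> schema set \<Rightarrow> schema set" for J \<Phi> where
  base: "\<phi> \<in> \<Phi> \<Longrightarrow> \<phi> \<in> descendants J \<Phi>"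
| step: "\<phi> \<in> descendants J \<Phi> \<Longrightarrow> \<psi> \<in> components J \<phi> \<Longrightarrow> \<psi> \<in> descendants J \<Phi>"

text \<open>Each schema has finitely many components, all strictly lighter, so induction on the
  weight applies.\<close>

lemma finite_descendants_singleton: "regular \<phi> \<Longrightarrow> finite (descendants J {\<phi>})"
proof (induction "iweight J \<phi>" arbitrary: \<phi> rule: less_induct)
  case less
  have "descendants J {\<phi>} \<subseteq> insert \<phi> (\<Union>\<psi>\<in>components J \<phi>. descendants J {\<psi>})"
  proof
    fix \<chi> assume "\<chi> \<in> descendants J {\<phi>}"
    then show "\<chi> \<in> insert \<phi> (\<Union>\<psi>\<in>components J \<phi>. descendants J {\<psi>})"
      by induction (auto intro: descendants.intros)
  qed
  moreover have "finite (\<Union>\<psi>\<in>components J \<phi>. descendants J {\<psi>})"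
    using less components_regular iweight_component_less finite_components by blast
  ultimately show ?case by (meson finite.insertI finite_subset)
qed

lemma finite_descendants:
  assumes "finite \<Phi>" "\<forall>\<phi>\<in>\<Phi>. regular \<phi>"
  shows "finite (descendants J \<Phi>)"
proof -
  have "descendants J \<Phi> \<subseteq> (\<Union>\<phi>\<in>\<Phi>. descendants J {\<phi>})"
  proof
    fix \<chi> assume "\<chi> \<in> descendants J \<Phi>"
    then show "\<chi> \<in> (\<Union>\<phi>\<in>\<Phi>. descendants J {\<phi>})"
      by induction (auto intro: descendants.intros)
  qed
  then show ?thesis using assms finite_descendants_singleton by (meson finite_UN_I finite_subset)
qed

text \<open>Termination needs only two kinds of steps. Truth of \<open>C\<close> in \<open>J\<close>
  ensures that the constraint chosen for an iteration is the one selected in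
  \<open>components\<close>.\<close>

lemma ext_rule_cases_models:
  assumes "ext_rule B P Cs" "C \<in> set Cs" "models_set J C"
  obtains (decompose) \<phi> where "P = {\<phi>}" "C \<subseteq> components J \<phi>"
  | (close) p a b where "P = {IProp p a, Neg (IProp p b)}" "C = P \<union> {Neq a b}" "Neq a b \<notin> B"
  using assms(1)
proof cases
  case (and_rule \<phi> \<psi>)
  then show ?thesis using assms(2) by (intro decompose[of "Conj \<phi> \<psi>"]) auto
next
  case (or_rule \<phi> \<psi>)
  then show ?thesis using assms(2) by (intro decompose[of "Disj \<phi> \<psi>"]) auto
next
  case (iterated_and i a b \<phi>)
  then show ?thesis using assms(2,3)
    by (intro decompose[of "BigConj i a b \<phi>"]) (auto simp: models_set_def)
next
  case (iterated_or i a b \<phi>)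
  then show ?thesis using assms(2,3)
    by (intro decompose[of "BigDisj i a b \<phi>"]) (auto simp: models_set_def)
next
  case (closure a b p)
  \<comment> \<open>By reflexivity of equivalence, absence up to equivalence implies literal
    absence.\<close>
  have "is_arith (Neq a b)" "sem_equiv (Neq a b) (Neq a b)"
    by (simp_all add: Neq_def sem_equiv_def)
  then have "Neq a b \<notin> B" using closure(3) unfolding occurs_upto_def by blast
  then show ?thesis using closure assms(2) by (intro close) auto
qed

text \<open>The disequations that closure may still introduce.\<close>

definition pending :: "schema set \<Rightarrow> schema set \<Rightarrow> schema set" where
  "pending D B = {Neq a b | a b. \<exists>p. IProp p a \<in> D \<and> Neg (IProp p b) \<in> D} - B"

lemma finite_pending:
  assumes "finite D"
  shows "finite (pending D B)"
proof -
  \<comment> \<open>Only an image covering the disequations is wanted; \<open>Top\<close> is a dummy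
    for pairs that are not complementary.\<close>
  define g where "g = (\<lambda>(\<phi>, \<psi>). case (\<phi>, \<psi>) of (IProp p a, Neg (IProp q b)) \<Rightarrow> Neq a b | _ \<Rightarrow> Top)"
  have "pending D B \<subseteq> g ` (D \<times> D)"
  proof
    fix \<chi> assume "\<chi> \<in> pending D B"
    then obtain a b p where "\<chi> = g (IProp p a, Neg (IProp p b))"
      "IProp p a \<in> D" "Neg (IProp p b) \<in> D"
      unfolding pending_def g_def by auto
    then show "\<chi> \<in> g ` (D \<times> D)" by blast
  qed
  then show ?thesis using assms by (meson finite_SigmaI finite_imageI finite_subset)
qed

text \<open>Closure uses up a pending disequation, though it may raise the weight; every other rule
  lowers the weight, and a growing branch never adds pending disequations. Hence the lexicographic
  order.\<close>

lemma ext_rule_decreases: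
  assumes rule: "ext_rule B P Cs" "C \<in> set Cs" "models_set J C"
    and P: "P \<subseteq> L" and L: "finite L" "\<forall>\<phi>\<in>L. regular \<phi>"
    and D: "finite (descendants J \<Phi>)" "L \<subseteq> descendants J \<Phi> \<union> {\<phi>. is_arith \<phi>}"
    and L': "L' = C \<union> (L - P)" and B': "B \<union> L' \<subseteq> B'"
  shows "finite L'" "L' \<subseteq> descendants J \<Phi> \<union> {\<phi>. is_arith \<phi>}"
    "((card (pending (descendants J \<Phi>) B'), sum (iweight J) L'),
      (card (pending (descendants J \<Phi>) B), sum (iweight J) L)) \<in> less_than <*lex*> less_than"
proof -
  let ?D = "descendants J \<Phi>"
  have mono: "pending ?D B' \<subseteq> pending ?D B" using B' by (auto simp: pending_def)
  then have le: "card (pending ?D B') \<le> card (pending ?D B)"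
    by (simp add: card_mono D(1) finite_pending)
  have "finite L' \<and> L' \<subseteq> ?D \<union> {\<phi>. is_arith \<phi>} \<and>
    ((card (pending ?D B'), sum (iweight J) L'), (card (pending ?D B), sum (iweight J) L))
      \<in> less_than <*lex*> less_than"
    using rule
  proof (cases rule: ext_rule_cases_models)
    case (decompose \<phi>)
    have \<phi>: "\<phi> \<in> L" "regular \<phi>" using decompose P L by auto
    have fin: "finite C" using decompose(2) finite_components finite_subset by blast
    have sub: "C \<subseteq> ?D \<union> {\<phi>. is_arith \<phi>}"
      using decompose(2) D(2) \<phi>(1) components_arith[of \<phi> _ J] descendants.step[of \<phi> J \<Phi>] by blast
    \<comment> \<open>The conclusion may overlap the rest of the label, so weights are only bounded
      by the sum of both parts.\<close>
    have "sum (iweight J) L' \<le> sum (iweight J) C + sum (iweight J) (L - P)"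
      unfolding L' using fin L(1) by (simp add: sum_Un_nat)
    moreover have "sum (iweight J) C \<le> sum (iweight J) (components J \<phi>)"
      using decompose(2) finite_components by (simp add: sum_mono2)
    moreover have "sum (iweight J) L = iweight J \<phi> + sum (iweight J) (L - P)"
      using decompose(1) \<phi>(1) L(1) by (simp add: sum.remove)
    ultimately have "sum (iweight J) L' < sum (iweight J) L"
      using iweight_components[of \<phi> J] \<phi>(2) by linarith
    then show ?thesis using le fin sub L(1) D(2) by (auto simp: L')
  next
    case (close p a b)
    have arith: "is_arith (Neq a b)" by (simp add: Neq_def)
    \<comment> \<open>The literals are not arithmetic, so \<open>D(2)\<close> leaves only the
      descendants.\<close>
    have "IProp p a \<in> ?D" "Neg (IProp p b) \<in> ?D" using close(1) P D(2) by auto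
    then have "Neq a b \<in> pending ?D B" using close(3) by (auto simp: pending_def)
    moreover have "Neq a b \<notin> pending ?D B'" using B' close(2) L' by (auto simp: pending_def)
    ultimately have "pending ?D B' \<subset> pending ?D B" using mono by blast
    then have "card (pending ?D B') < card (pending ?D B)"
      by (simp add: psubset_card_mono D(1) finite_pending)
    moreover have "finite C" "C \<subseteq> ?D \<union> {\<phi>. is_arith \<phi>}"
      using close P D(2) arith by auto
    ultimately show ?thesis using L(1) D(2) by (auto simp: L')
  qed
  then show "finite L'" "L' \<subseteq> ?D \<union> {\<phi>. is_arith \<phi>}"
    "((card (pending ?D B'), sum (iweight J) L'), (card (pending ?D B), sum (iweight J) L))
      \<in> less_than <*lex*> less_than" by auto
qed

text \<open>Well-founded induction along leaves true in \<open>J\<close>; \<open>start\<close> is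
  the invariant passed from a leaf to its chosen child.\<close>

lemma fair_derivation_reaches_irreducible:
  assumes der: "derivation I T" and tree: "\<And>\<iota>. \<iota> \<in> I \<Longrightarrow> rule_tree \<Phi> (T \<iota>)"
    and \<Phi>: "finite \<Phi>" "\<forall>\<phi>\<in>\<Phi>. regular \<phi>" "models_set J \<Phi>"
    and unblocked: "\<And>\<iota> N. \<iota> \<in> I \<Longrightarrow> models_set J (label (T \<iota>) N) \<Longrightarrow> \<not> blocked (T \<iota>) N"
    and progress: "\<And>\<iota> N. \<iota> \<in> I \<Longrightarrow> N \<in> leaves (T \<iota>) \<Longrightarrow> \<not> closed_leaf (T \<iota>) N \<Longrightarrow>
      \<not> irreducible_leaf (T \<iota>) N \<Longrightarrow> \<exists>\<mu>\<ge>\<iota>. Suc \<mu> \<in> I \<and> rule_applied (T \<mu>) N (T (Suc \<mu>))"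
    and start: "\<iota> \<in> I" "N \<in> leaves (T \<iota>)" "models_set J (label (T \<iota>) N)"
      "finite (label (T \<iota>) N)" "label (T \<iota>) N \<subseteq> descendants J \<Phi> \<union> {\<phi>. is_arith \<phi>}"
  shows "\<exists>\<iota>\<in>I. \<exists>N\<in>leaves (T \<iota>). irreducible_leaf (T \<iota>) N \<and> \<not> closed_leaf (T \<iota>) N"
proof -
  let ?D = "descendants J \<Phi>"
  define f where "f = (\<lambda>(\<iota>, N). (card (pending ?D (branch_schemata (T \<iota>) N)),
    sum (iweight J) (label (T \<iota>) N)))"
  have "wf (inv_image (less_than <*lex*> less_than) f)" by auto
  then show ?thesis using start
  proof (induction "(\<iota>, N)" arbitrary: \<iota> N rule: wf_induct_rule)
    case less
    have N: "N \<in> nodes (T \<iota>)" using less.prems(2) by (simp add: leaves_def)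
    \<comment> \<open>\<open>J\<close> itself satisfies the arithmetic part of the label.\<close>
    have opened: "\<not> closed_leaf (T \<iota>) N"
      using unblocked[OF less.prems(1,3)] less.prems(3)
      by (auto simp: closed_leaf_def models_set_def)
    show ?case
    proof (cases "irreducible_leaf (T \<iota>) N")
      case True
      then show ?thesis using less.prems opened by blast
    next
      case False
      then obtain \<mu> where \<mu>: "\<iota> \<le> \<mu>" "Suc \<mu> \<in> I" and app: "rule_applied (T \<mu>) N (T (Suc \<mu>))"
        using progress less.prems(1,2) opened by blast
      have \<mu>_I: "\<mu> \<in> I" using derivation_downward[OF der \<mu>(2)] by simp
      have pers: "T \<mu> M = T \<iota> M" if "M \<in> nodes (T \<iota>)" for M
        using derivation_persistent[OF der \<mu>_I \<mu>(1) that] .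
      have lab: "label (T \<mu>) N = label (T \<iota>) N" using pers N by (simp add: label_def)
      have branch: "branch_schemata (T \<iota>) N \<subseteq> branch_schemata (T \<mu>) N"
      proof
        fix \<phi> assume "\<phi> \<in> branch_schemata (T \<iota>) N"
        then obtain M where M: "M \<in> nodes (T \<iota>)" "prefix M N" "\<phi> \<in> label (T \<iota>) M"
          unfolding branch_schemata_def by blast
        then have "M \<in> nodes (T \<mu>)" "\<phi> \<in> label (T \<mu>) M"
          using pers[OF M(1)] by (simp_all add: nodes_def domIff label_def)
        then show "\<phi> \<in> branch_schemata (T \<mu>) N"
          using M(2) unfolding branch_schemata_def by blast
      qed
      obtain P Cs where leaf: "N \<in> leaves (T \<mu>)"
        and rule: "ext_rule (branch_schemata (T \<mu>) N) P Cs"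
        and P: "P \<subseteq> label (T \<mu>) N" and T': "T (Suc \<mu>) = extend (T \<mu>) N P Cs"
        using app unfolding rule_applied_def by blast
      have N_\<mu>: "N \<in> nodes (T \<mu>)" using leaf by (simp add: leaves_def)
      have regular: "\<forall>\<phi>\<in>label (T \<mu>) N. regular \<phi>"
        using rule_tree_regular[OF tree[OF \<mu>_I] \<Phi>(2) N_\<mu>] .
      \<comment> \<open>Soundness selects the child that is true in \<open>J\<close>.\<close>
      obtain k where k: "k < length Cs" "models_set J (Cs ! k)"
        using ext_rule_sound[OF rule, of J] P regular less.prems(3) lab
        by (metis in_set_conv_nth models_set_def subsetD)
      let ?N' = "N @ [k]"
      have N': "label (T (Suc \<mu>)) ?N' = Cs ! k \<union> (label (T \<mu>) N - P)"
        using extend_child[OF k(1)] by (simp add: T' label_def[of "extend _ _ _ _"])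
      have N'_node: "?N' \<in> nodes (T (Suc \<mu>))"
        using extend_child[OF k(1)] by (simp add: T' nodes_def domI)
      have old: "T (Suc \<mu>) M = T \<mu> M" if "M \<in> nodes (T \<mu>)" for M
        using rule_applied_persistent[OF app that] .
      \<comment> \<open>Only children of \<open>N\<close> are new, so a child of \<open>?N'\<close>
        would be old, and then so would \<open>?N'\<close>, although \<open>N\<close> was a
        leaf.\<close>
      have "?N' @ [j] \<notin> nodes (T (Suc \<mu>))" for j
      proof
        assume "?N' @ [j] \<in> nodes (T (Suc \<mu>))"
        then have "?N' @ [j] \<in> nodes (T \<mu>)"
          by (auto simp: T' extend_def nodes_def split: if_splits)
        then have "?N' \<in> nodes (T \<mu>)" using tree[OF \<mu>_I] unfolding rule_tree_def by blast
        then show False using leaf by (simp add: leaves_def)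
      qed
      then have N'_leaf: "?N' \<in> leaves (T (Suc \<mu>))" using N'_node by (simp add: leaves_def)
      have models_N': "models_set J (label (T (Suc \<mu>)) ?N')"
        using k(2) less.prems(3) by (auto simp: N' lab models_set_def)
      have "label (T \<mu>) M \<subseteq> branch_schemata (T (Suc \<mu>)) ?N'" if "M \<in> nodes (T \<mu>)" "prefix M N" for M
      proof -
        have "M \<in> nodes (T (Suc \<mu>))" "label (T (Suc \<mu>)) M = label (T \<mu>) M"
          using old[OF that(1)] that(1) by (simp_all add: nodes_def domIff label_def)
        then show ?thesis using that(2) unfolding branch_schemata_def by force
      qed
      moreover have "label (T (Suc \<mu>)) ?N' \<subseteq> branch_schemata (T (Suc \<mu>)) ?N'"
        using N'_node unfolding branch_schemata_def by blast
      ultimately have branch':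
        "branch_schemata (T \<mu>) N \<union> label (T (Suc \<mu>)) ?N' \<subseteq> branch_schemata (T (Suc \<mu>)) ?N'"
        unfolding branch_schemata_def[of "T \<mu>"] by blast
      note decrease = ext_rule_decreases[OF rule nth_mem[OF k(1)] k(2) P
          less.prems(4)[folded lab] regular finite_descendants[OF \<Phi>(1,2)]
          less.prems(5)[folded lab] N' branch']
      \<comment> \<open>Waiting from stage \<iota> to \<mu> does not increase the measure.\<close>
      have "card (pending ?D (branch_schemata (T \<mu>) N))
          \<le> card (pending ?D (branch_schemata (T \<iota>) N))"
        using branch finite_descendants[OF \<Phi>(1,2)]
        by (intro card_mono finite_pending) (auto simp: pending_def)
      then have "((Suc \<mu>, ?N'), (\<iota>, N)) \<in> inv_image (less_than <*lex*> less_than) f"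
        using decrease(3) by (auto simp: f_def lab)
      then show ?thesis
        using less.hyps \<mu>(2) N'_leaf models_N' decrease(1,2) by blast
    qed
  qed
qed


section \<open>Minimal models\<close>

text \<open>Values are natural, so from such an interpretation a shift can lower only variables in
  \<open>V\<close>.\<close>

definition vanishes_off :: "avar set \<Rightarrow> interp \<Rightarrow> bool" where
  "vanishes_off V J \<longleftrightarrow> (\<forall>n. n \<notin> V \<longrightarrow> aint J n = 0)"

lemma interp_less_aint:
  assumes "interp_less K J"
  shows "\<forall>n. aint K n \<le> aint J n" "\<exists>n. aint K n < aint J n"
proof -
  obtain d where d: "\<And>n. int (aint K n) = int (aint J n) - int (d n)" and pos: "\<exists>n. d n > 0"
    using assms unfolding interp_less_def is_shift_def is_subst_interp_def
    by (auto simp: ieval_def intro: that)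
  show "\<forall>n. aint K n \<le> aint J n"
  proof
    fix n show "aint K n \<le> aint J n" using d[of n] by linarith
  qed
  obtain n where "d n > 0" using pos by blast
  then show "\<exists>n. aint K n < aint J n" using d[of n] by (intro exI[of _ n]) linarith
qed

text \<open>Without the restriction to a finite set of relevant variables, \<open>interp_less\<close> is not well-founded.\<close>

lemma interp_less_sum:
  assumes "interp_less K J" "finite V" "vanishes_off V J"
  shows "vanishes_off V K" "sum (aint K) V < sum (aint J) V"
proof -
  note le = interp_less_aint(1)[OF assms(1)]
  show "vanishes_off V K" using le assms(3) unfolding vanishes_off_def by (metis le_zero_eq)
  obtain n where n: "aint K n < aint J n" using interp_less_aint(2)[OF assms(1)] by blast
  then have "n \<in> V" using assms(3) unfolding vanishes_off_def by (metis not_less_zero)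
  then show "sum (aint K) V < sum (aint J) V"
    using le n assms(2) by (intro sum_strict_mono_ex1) auto
qed

text \<open>A finite support of \<Phi> reduces minimality to that of a natural number, the sum of
  the relevant values.\<close>

lemma exists_minimal_model:
  assumes "finite \<Phi>" "models_set K \<Phi>"
  obtains J where "models_set J \<Phi>" "\<And>J'. interp_less J' J \<Longrightarrow> \<not> models_set J' \<Phi>"
proof -
  obtain V where V: "\<And>\<phi>. finite (V \<phi>)" "\<And>\<phi>. supports (V \<phi>) \<phi>"
    using finite_support by metis
  let ?V = "\<Union>\<phi>\<in>\<Phi>. V \<phi>"
  have fin: "finite ?V" using assms(1) V(1) by blast
  let ?Q = "\<lambda>J. models_set J \<Phi> \<and> vanishes_off ?V J"
  \<comment> \<open>Setting the irrelevant variables to 0 preserves truth on \<Phi> and provides a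
    candidate for minimization.\<close>
  define K' where "K' = Interp (\<lambda>n. if n \<in> ?V then aint K n else 0) (pint K)"
  have "models K' \<phi>" if "\<phi> \<in> \<Phi>" for \<phi>
  proof -
    have "models K' \<phi> = models K \<phi>"
      using that unfolding models_def K'_def interp.sel
      by (intro supportsD[OF V(2)]) auto
    then show ?thesis using assms(2) that by (simp add: models_set_def)
  qed
  then have "?Q K'" by (simp add: models_set_def vanishes_off_def K'_def)
  then obtain J where J: "?Q J" and min: "\<And>J'. ?Q J' \<Longrightarrow> sum (aint J) ?V \<le> sum (aint J') ?V"
    using ex_has_least_nat[of ?Q K' "\<lambda>J. sum (aint J) ?V"] by blast
  \<comment> \<open>A smaller model would again vanish off \<open>?V\<close>, with a strictly
    smaller sum.\<close>
  have "\<not> models_set J' \<Phi>" if "interp_less J' J" for J'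
    using interp_less_sum[OF that fin] J min[of J'] by fastforce
  then show thesis using J that by blast
qed

theorem theorem5p19:
  fixes I :: "nat set" and T :: "nat \<Rightarrow> tableau"
  assumes "derivation I T"
  shows "((\<exists>\<iota>\<in>I. \<exists>N\<in>leaves (T \<iota>). irreducible_leaf (T \<iota>) N \<and> \<not> closed_leaf (T \<iota>) N)
            \<longrightarrow> satisfiable (T 0)) \<and>
         (finite (label (T 0) []) \<and> fair I T \<and> satisfiable (T 0)
            \<longrightarrow> (\<exists>\<iota>\<in>I. \<exists>N\<in>leaves (T \<iota>). irreducible_leaf (T \<iota>) N \<and>
                   \<not> closed_leaf (T \<iota>) N \<and> \<not> blocked (T \<iota>) N))"
proof -
  obtain \<Phi> where regular: "\<forall>\<phi>\<in>\<Phi>. regular \<phi>" and T0: "T 0 = [[] \<mapsto> \<Phi>]"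
    and tree: "\<And>\<iota>. \<iota> \<in> I \<Longrightarrow> rule_tree \<Phi> (T \<iota>)"
    using derivation_rule_tree[OF assms] by metis
  have root: "leaves (T 0) = {[]}" "label (T 0) [] = \<Phi>"
    by (auto simp: T0 leaves_def nodes_def label_def)
  then have sat_root: "satisfiable (T 0) \<longleftrightarrow> (\<exists>J. models_set J \<Phi>)"
    by (simp add: satisfiable_def satisfied_in_def)
  have not_blocked: "\<not> blocked (T \<iota>) N" if "\<not> closed_leaf (T \<iota>) N" for \<iota> N
    using that by (auto simp: closed_leaf_def blocked_def)
  show ?thesis
  proof (intro conjI impI; (elim conjE bexE)?)
    fix \<iota> N assume \<iota>: "\<iota> \<in> I" and N: "N \<in> leaves (T \<iota>)"
      and leaf: "irreducible_leaf (T \<iota>) N" "\<not> closed_leaf (T \<iota>) N"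
    obtain J where J: "models_set J (label (T \<iota>) N)"
      using irreducible_leaf_satisfiable[OF tree[OF \<iota>] regular leaf] by blast
    then have "models_set J \<Phi>"
      using rule_tree_models_root[OF tree[OF \<iota>] regular] N
        J unfolding leaves_def by blast
    then show "satisfiable (T 0)" using sat_root by blast
  next
    assume fin: "finite (label (T 0) [])" and fair: "fair I T" and sat: "satisfiable (T 0)"
    have "\<exists>\<iota>\<in>I. \<exists>N\<in>leaves (T \<iota>). irreducible_leaf (T \<iota>) N \<and> \<not> closed_leaf (T \<iota>) N"
    proof (rule ccontr)
      assume none: "\<not> ?thesis"
      \<comment> \<open>Finiteness yields both a finite set of relevant variables and finitely many
        descendants.\<close>
      have fin_\<Phi>: "finite \<Phi>" using fin root by simp
      obtain J where J: "models_set J \<Phi>" and min: "\<And>J'. interp_less J' J \<Longrightarrow> \<not> models_set J' \<Phi>"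
        using sat sat_root exists_minimal_model[OF fin_\<Phi>] by metis
      have "0 \<in> I" using assms unfolding derivation_def by auto
      \<comment> \<open>A loop would give a model, smaller than \<open>J\<close>, of the label of
        some node and thus of the root.\<close>
      have unblocked: "\<not> blocked (T \<iota>) N" if "\<iota> \<in> I" "models_set J (label (T \<iota>) N)" for \<iota> N
        using that(2) min rule_tree_models_root[OF tree[OF that(1)] regular]
        unfolding blocked_def loops_on_def shift_entails_def by blast
      \<comment> \<open>The assumption \<open>none\<close> excludes the first alternative of
        fairness.\<close>
      have progress: "\<exists>\<mu>\<ge>\<iota>. Suc \<mu> \<in> I \<and> rule_applied (T \<mu>) N (T (Suc \<mu>))"
        if "\<iota> \<in> I" "N \<in> leaves (T \<iota>)" "\<not> closed_leaf (T \<iota>) N" for \<iota> N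
        using fair none that not_blocked unfolding fair_def by blast
      have "\<exists>\<iota>\<in>I. \<exists>N\<in>leaves (T \<iota>). irreducible_leaf (T \<iota>) N \<and> \<not> closed_leaf (T \<iota>) N"
        using fin_\<Phi> J
        by (intro fair_derivation_reaches_irreducible[OF assms tree fin_\<Phi> regular J unblocked
            progress \<open>0 \<in> I\<close>, of "[]"]) (auto simp: root intro: descendants.base)
      then show False using none by blast
    qed
    then show "\<exists>\<iota>\<in>I. \<exists>N\<in>leaves (T \<iota>). irreducible_leaf (T \<iota>) N \<and>
        \<not> closed_leaf (T \<iota>) N \<and> \<not> blocked (T \<iota>) N"
      using not_blocked by blast
  qed
qed

end
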